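(* Let $\theta>0$ be a real number with $\theta^2=\alpha+\sqrt{\beta}$ or $\theta^2=\alpha-\sqrt{\beta}$, where $\alpha,\beta\in\mathbb{Q}$, $\alpha>0$, $\beta>0$, and $\sqrt{\beta}\notin\mathbb{Q}$. Then $\theta$ is good if and only if there exist a positive rational $\lambda$ and positive integers $a,b,c$ with $\gcd(a,b,c)=1$ forming a non-degenerate triangle (i.e. each is strictly less than the sum of the other two), with area $\Delta$ satisfying $4\Delta\sqrt{3}\notin\mathbb{Q}$, such that $$2(\lambda\theta)^2=(a^2+b^2+c^2)+4\Delta\sqrt{3}\quad\text{or}\quad 2(\lambda\theta)^2=(a^2+b^2+c^2)-4\Delta\sqrt{3}.$$
   Context: A positive real number $\theta$ is called "good" if, for the equilateral triangle $T$ with side length $\theta$ in the Euclidean plane, there is a point in the plane of $T$ whose distances to all three vertices of $T$ are rational numbers. For a triangle with side lengths $a,b,c$, the area is $\Delta=\sqrt{s(s-a)(s-b)(s-c)}$ with $s=\tfrac12(a+b+c)$; equivalently $4\Delta\sqrt{3}=\sqrt{3(a+b+c)(-a+b+c)(a-b+c)(a+b-c)}$. *)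

theory Defs
  imports "HOL-Analysis.Analysis"
begin

text \<open>All equilateral triangles of a given side are congruent, so it does not matter which
  one is chosen; the definition asks for some such triangle.\<close>

definition good :: "real \<Rightarrow> bool" where
  "good \<theta> \<longleftrightarrow> \<theta> > 0 \<and>
     (\<exists>A B C :: real^2. dist A B = \<theta> \<and> dist B C = \<theta> \<and> dist C A = \<theta> \<and>
        (\<exists>P :: real^2. dist P A \<in> \<rat> \<and> dist P B \<in> \<rat> \<and> dist P C \<in> \<rat>))"

definition heron_area :: "real \<Rightarrow> real \<Rightarrow> real \<Rightarrow> real" where
  "heron_area a b c =
     (let s = (a + b + c) / 2 in sqrt (s * (s - a) * (s - b) * (s - c)))"

end

theory Submission
  imports Defs
begin

text \<open>If a point of the plane has distances \<open>p\<close>, \<open>q\<close>, \<open>r\<close> to the vertices of an equilateral triangle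
  of side \<open>\<theta>\<close>, the vanishing of a Gram determinant gives a quadratic equation for \<open>\<theta>\<^sup>2\<close> whose
  discriminant is, up to squares, Heron's product for \<open>p\<close>, \<open>q\<close>, \<open>r\<close> times 3. Conversely the equation
  suffices to construct the point from coordinates. When \<open>\<theta>\<^sup>2\<close> is irrational the discriminant is not
  the square of a rational, hence positive, which forces \<open>p\<close>, \<open>q\<close>, \<open>r\<close> to form a non-degenerate
  triangle; clearing denominators and common factors gives the integer triangle.\<close>

text \<open>Sixteen times the squared area of a triangle. Unlike \<open>heron_area\<close> it is a
  polynomial, so identities for it fall to \<open>algebra\<close>, and it is negative when exactly
  one triangle inequality fails strictly for nonnegative sides.\<close>

definition heron_product :: "real \<Rightarrow> real \<Rightarrow> real \<Rightarrow> real" where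
  "heron_product a b c = (a + b + c) * (- a + b + c) * (a - b + c) * (a + b - c)"

text \<open>Each of the four half-perimeter factors contributes 1/2, so the radicand is
  \<open>heron_product\<close> over 16. No sign condition arises, as real \<open>sqrt\<close> is
  multiplicative on all reals.\<close>

lemma four_heron_area_sqrt3:
  "4 * heron_area a b c * sqrt 3 = sqrt (3 * heron_product a b c)"
proof -
  have "heron_area a b c = sqrt (heron_product a b c / 4\<^sup>2)"
    unfolding heron_area_def heron_product_def Let_def
    by (rule arg_cong[where f = sqrt]) (simp add: field_simps power2_eq_square)
  then have "4 * heron_area a b c = sqrt (heron_product a b c)"
    by (simp add: real_sqrt_divide)
  then show ?thesis
    by (simp add: real_sqrt_mult)
qed

lemma heron_product_scale:
  "heron_product (k * a) (k * b) (k * c) = k ^ 4 * heron_product a b c"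
  unfolding heron_product_def by algebra

text \<open>If one side were at least the sum of the other two, its factor would be nonpositive and
  the other three nonnegative. Symmetry covers all sides, and adding two strict inequalities makes
  the third side positive.\<close>

lemma strict_triangle_if_heron_product_pos:
  assumes "0 \<le> a" "0 \<le> b" "0 \<le> c" "heron_product a b c > 0"
  shows "a < b + c" "b < a + c" "c < a + b" "0 < a" "0 < b" "0 < c"
proof -
  have *: "z < x + y"
    if "0 \<le> x" "0 \<le> y" "0 \<le> z" and pos: "heron_product x y z > 0" for x y z :: real
  proof (rule ccontr)
    assume "\<not> z < x + y"
    then have "(x + y + z) * (- x + y + z) * (x - y + z) \<ge> 0" "x + y - z \<le> 0"
      using that by (auto intro!: mult_nonneg_nonneg)
    then have "heron_product x y z \<le> 0"
      unfolding heron_product_def by (rule mult_nonneg_nonpos)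
    then show False using pos by simp
  qed
  have perm: "heron_product b c a = heron_product a b c" "heron_product a c b = heron_product a b c"
    unfolding heron_product_def by algebra+
  show "c < a + b" using *[of a b c] assms by simp
  moreover show "b < a + c" using *[of a c b] assms perm by simp
  moreover show "a < b + c" using *[of b c a] assms perm by simp
  ultimately show "0 < a" "0 < b" "0 < c" by linarith+
qed

lemma dist_vec2: "(dist P A)\<^sup>2 = (P$1 - A$1)\<^sup>2 + (P$2 - A$2)\<^sup>2" for P A :: "real^2"
  unfolding dist_norm power2_norm_eq_inner by (simp add: inner_vec_def sum_2 power2_eq_square)

lemma equilateral_distances_relation:
  fixes A B C P :: "real^2"
  assumes "\<theta> > 0" "dist A B = \<theta>" "dist B C = \<theta>" "dist C A = \<theta>"
    and "dist P A = p" "dist P B = q" "dist P C = r"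
  shows "(2 * \<theta>\<^sup>2 - (p\<^sup>2 + q\<^sup>2 + r\<^sup>2))\<^sup>2 = 3 * heron_product p q r"
proof -
  define u1 u2 v1 v2 w1 w2 where defs: "u1 = B$1 - A$1" "u2 = B$2 - A$2"
    "v1 = C$1 - A$1" "v2 = C$2 - A$2" "w1 = P$1 - A$1" "w2 = P$2 - A$2"
  have eqs: "\<theta>\<^sup>2 = u1\<^sup>2 + u2\<^sup>2" "\<theta>\<^sup>2 = (u1 - v1)\<^sup>2 + (u2 - v2)\<^sup>2" "\<theta>\<^sup>2 = v1\<^sup>2 + v2\<^sup>2"
      "p\<^sup>2 = w1\<^sup>2 + w2\<^sup>2" "q\<^sup>2 = (w1 - u1)\<^sup>2 + (w2 - u2)\<^sup>2" "r\<^sup>2 = (w1 - v1)\<^sup>2 + (w2 - v2)\<^sup>2"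
    using assms(2-) dist_vec2[of A B] dist_vec2[of B C] dist_vec2[of C A]
      dist_vec2[of P A] dist_vec2[of P B] dist_vec2[of P C]
    unfolding defs by (simp_all add: power2_commute)
  define m n where "m = u1 * w1 + u2 * w2" and "n = v1 * w1 + v2 * w2"
  have uv: "u1 * v1 + u2 * v2 = \<theta>\<^sup>2 / 2"
    using eqs(1-3) by (simp add: power2_eq_square algebra_simps)
  have m: "m = (p\<^sup>2 + \<theta>\<^sup>2 - q\<^sup>2) / 2" and n: "n = (p\<^sup>2 + \<theta>\<^sup>2 - r\<^sup>2) / 2"
    using eqs unfolding m_def n_def by (simp_all add: power2_eq_square algebra_simps)
  \<comment> \<open>The Gram determinant of the vectors from \<open>A\<close> to \<open>B\<close>,
    \<open>C\<close> and \<open>P\<close>; it vanishes because three vectors in the plane are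
    dependent.\<close>
  have "(u1\<^sup>2 + u2\<^sup>2) * (v1\<^sup>2 + v2\<^sup>2) * (w1\<^sup>2 + w2\<^sup>2) + 2 * (u1 * v1 + u2 * v2) * m * n
      - (u1\<^sup>2 + u2\<^sup>2) * n\<^sup>2 - (v1\<^sup>2 + v2\<^sup>2) * m\<^sup>2 - (w1\<^sup>2 + w2\<^sup>2) * (u1 * v1 + u2 * v2)\<^sup>2 = 0"
    unfolding m_def n_def by algebra
  then have "\<theta>\<^sup>2 * \<theta>\<^sup>2 * p\<^sup>2 + 2 * (\<theta>\<^sup>2 / 2) * m * n - \<theta>\<^sup>2 * n\<^sup>2 - \<theta>\<^sup>2 * m\<^sup>2 - p\<^sup>2 * (\<theta>\<^sup>2 / 2)\<^sup>2 = 0"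
    unfolding uv eqs(1)[symmetric] eqs(3)[symmetric] eqs(4)[symmetric] .
  then have "\<theta>\<^sup>2 * (3 / 4 * \<theta>\<^sup>2 * p\<^sup>2 + m * n - n\<^sup>2 - m\<^sup>2) = 0"
    by (simp add: power2_eq_square algebra_simps)
  then have "3 / 4 * \<theta>\<^sup>2 * p\<^sup>2 + m * n - n\<^sup>2 - m\<^sup>2 = 0"
    using \<open>\<theta> > 0\<close> by simp
  \<comment> \<open>What remains is quadratic in \<open>\<theta>\<^sup>2\<close>; completing the
    square gives the claim.\<close>
  then show ?thesis
    unfolding m n heron_product_def by (simp add: power2_eq_square field_simps)
qed

lemma equilateral_point_exists:
  fixes \<theta> p q r :: real
  assumes "\<theta> > 0" "0 \<le> p" "0 \<le> q" "0 \<le> r"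
    and rel: "(2 * \<theta>\<^sup>2 - (p\<^sup>2 + q\<^sup>2 + r\<^sup>2))\<^sup>2 = 3 * heron_product p q r"
  shows "\<exists>A B C P :: real^2. dist A B = \<theta> \<and> dist B C = \<theta> \<and> dist C A = \<theta> \<and>
           dist P A = p \<and> dist P B = q \<and> dist P C = r"
proof -
  \<comment> \<open>With \<open>A\<close> at the origin and \<open>B\<close> on the first axis,
    subtracting the distance equations pairwise leaves linear equations, whose solution is this
    point.\<close>
  define x y where "x = (\<theta>\<^sup>2 + p\<^sup>2 - q\<^sup>2) / (2 * \<theta>)"
    and "y = (\<theta>\<^sup>2 + p\<^sup>2 + q\<^sup>2 - 2 * r\<^sup>2) / (2 * sqrt 3 * \<theta>)"
  have x: "2 * \<theta> * x = \<theta>\<^sup>2 + p\<^sup>2 - q\<^sup>2"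
    and y: "2 * \<theta> * (sqrt 3 * y) = \<theta>\<^sup>2 + p\<^sup>2 + q\<^sup>2 - 2 * r\<^sup>2"
    using \<open>\<theta> > 0\<close> by (simp_all add: x_def y_def)
  have s3: "(sqrt 3)\<^sup>2 = (3::real)" by simp
  \<comment> \<open>The linear equations fix only differences of squared distances. The hypothesis
    \<open>rel\<close> supplies the missing distance to \<open>A\<close>; the weight 3 clears the
    factor \<open>sqrt 3\<close> in \<open>y\<close>.\<close>
  have "3 * (2 * \<theta> * x)\<^sup>2 + (2 * \<theta> * (sqrt 3 * y))\<^sup>2 = 12 * \<theta>\<^sup>2 * p\<^sup>2"
    unfolding x y using rel unfolding heron_product_def by algebra
  then have "12 * \<theta>\<^sup>2 * (x\<^sup>2 + y\<^sup>2) = 12 * \<theta>\<^sup>2 * p\<^sup>2"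
    using s3 by algebra
  then have p: "x\<^sup>2 + y\<^sup>2 = p\<^sup>2" using \<open>\<theta> > 0\<close> by simp
  have q: "(x - \<theta>)\<^sup>2 + y\<^sup>2 = q\<^sup>2"
    using p x by (simp add: power2_eq_square algebra_simps)
  have r: "(x - \<theta> / 2)\<^sup>2 + (y - sqrt 3 / 2 * \<theta>)\<^sup>2 = r\<^sup>2"
    using p x y by (simp add: power2_eq_square algebra_simps)
  have d: "dist P Q = t" if "(P$1 - Q$1)\<^sup>2 + (P$2 - Q$2)\<^sup>2 = t\<^sup>2" "0 \<le> t"
    for P Q :: "real^2" and t
    using that dist_vec2[of P Q] by simp
  let ?A = "vector [0, 0] :: real^2" and ?B = "vector [\<theta>, 0] :: real^2"
    and ?C = "vector [\<theta> / 2, sqrt 3 / 2 * \<theta>] :: real^2" and ?P = "vector [x, y] :: real^2"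
  have "dist ?A ?B = \<theta>" "dist ?B ?C = \<theta>" "dist ?C ?A = \<theta>"
    using \<open>\<theta> > 0\<close> by (intro d; simp add: vector_2 power2_eq_square algebra_simps)+
  moreover have "dist ?P ?A = p" "dist ?P ?B = q" "dist ?P ?C = r"
    using assms(2-4) p q r by (intro d; simp add: vector_2)+
  ultimately show ?thesis by blast
qed

text \<open>This removes the geometry: both directions of the theorem now only rescale a relation
  that is homogeneous of degree 4 in \<theta>, \<open>p\<close>, \<open>q\<close>,
  \<open>r\<close>.\<close>

lemma good_iff_relation:
  assumes "\<theta> > 0"
  shows "good \<theta> \<longleftrightarrow> (\<exists>p\<in>\<rat>. \<exists>q\<in>\<rat>. \<exists>r\<in>\<rat>. 0 \<le> p \<and> 0 \<le> q \<and> 0 \<le> r \<and>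
    (2 * \<theta>\<^sup>2 - (p\<^sup>2 + q\<^sup>2 + r\<^sup>2))\<^sup>2 = 3 * heron_product p q r)" (is "_ \<longleftrightarrow> ?R")
proof
  assume "good \<theta>"
  then obtain A B C P :: "real^2" where tri: "dist A B = \<theta>" "dist B C = \<theta>" "dist C A = \<theta>"
    and rat: "dist P A \<in> \<rat>" "dist P B \<in> \<rat>" "dist P C \<in> \<rat>"
    unfolding good_def by blast
  show ?R
    using equilateral_distances_relation[OF assms tri refl refl refl] rat zero_le_dist by blast
next
  assume ?R
  then obtain p q r where "p \<in> \<rat>" "q \<in> \<rat>" "r \<in> \<rat>" and
    *: "0 \<le> p" "0 \<le> q" "0 \<le> r" "(2 * \<theta>\<^sup>2 - (p\<^sup>2 + q\<^sup>2 + r\<^sup>2))\<^sup>2 = 3 * heron_product p q r"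
    by blast
  with equilateral_point_exists[OF assms *] assms show "good \<theta>"
    unfolding good_def by metis
qed

lemma pos_Rats_common_primitive_multiple:
  fixes p q r :: real
  assumes "p \<in> \<rat>" "q \<in> \<rat>" "r \<in> \<rat>" "0 < p" "0 < q" "0 < r"
  obtains l :: real and a b c :: nat
  where "l \<in> \<rat>" "l > 0" "a > 0" "b > 0" "c > 0" "gcd a (gcd b c) = 1"
    "real a = l * p" "real b = l * q" "real c = l * r"
proof -
  have frac: "\<exists>m n :: nat. m > 0 \<and> n > 0 \<and> x = real m / real n" if "x \<in> \<rat>" "0 < x" for x :: real
  proof -
    obtain m n :: nat where "n \<noteq> 0" "\<bar>x\<bar> = real m / real n"
      using Rats_abs_nat_div_natE[OF \<open>x \<in> \<rat>\<close>] by metis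
    then show ?thesis using \<open>0 < x\<close>
      by (intro exI[of _ m] exI[of _ n]) (auto intro!: Nat.gr0I)
  qed
  obtain p1 p2 :: nat where p: "p1 > 0" "p2 > 0" "p = real p1 / real p2"
    using frac assms by blast
  obtain q1 q2 :: nat where q: "q1 > 0" "q2 > 0" "q = real q1 / real q2"
    using frac assms by blast
  obtain r1 r2 :: nat where r: "r1 > 0" "r2 > 0" "r = real r1 / real r2"
    using frac assms by blast
  define x y z where "x = p1 * q2 * r2" and "y = q1 * p2 * r2" and "z = r1 * p2 * q2"
  define g where "g = gcd x (gcd y z)"
  \<comment> \<open>Multiplying by the common denominator gives the integers \<open>x\<close>,
    \<open>y\<close>, \<open>z\<close>; dividing by \<open>g\<close> makes them coprime.\<close>
  define l where "l = real (p2 * q2 * r2) / real g"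
  have pos: "x > 0" "y > 0" "z > 0" using p q r by (simp_all add: x_def y_def z_def)
  then have "g > 0" by (simp add: g_def)
  have dvd: "g dvd x" "g dvd y" "g dvd z"
    unfolding g_def by (auto intro: dvd_trans[OF gcd_dvd2])
  obtain a b c where abc: "x = g * a" "y = g * b" "z = g * c"
    using dvd by (auto elim!: dvdE)
  have "g * gcd a (gcd b c) = gcd x (gcd y z)"
    unfolding abc by (simp only: gcd_mult_distrib_nat)
  also have "\<dots> = g * 1" by (simp only: g_def mult_1_right)
  finally have "gcd a (gcd b c) = 1" using \<open>g > 0\<close> by simp
  have "a > 0" "b > 0" "c > 0" using pos abc by auto
  have "l \<in> \<rat>" "l > 0" using p q r \<open>g > 0\<close> by (simp_all add: l_def)
  have "real a = real x / real g" "real b = real y / real g" "real c = real z / real g"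
    using abc \<open>g > 0\<close> by simp_all
  then have "real a = l * p" "real b = l * q" "real c = l * r"
    using p q r \<open>g > 0\<close> by (simp_all add: l_def x_def y_def z_def field_simps)
  show ?thesis by (rule that[of l a b c]) fact+
qed

theorem theorem2:
  fixes \<theta> \<alpha> \<beta> :: real
  assumes "\<theta> > 0"
    and "\<alpha> \<in> \<rat>" and "\<beta> \<in> \<rat>" and "\<alpha> > 0" and "\<beta> > 0" and "sqrt \<beta> \<notin> \<rat>"
    and "\<theta>\<^sup>2 = \<alpha> + sqrt \<beta> \<or> \<theta>\<^sup>2 = \<alpha> - sqrt \<beta>"
  shows "good \<theta> \<longleftrightarrow>
    (\<exists>(l::real) (a::nat) (b::nat) (c::nat).
       l \<in> \<rat> \<and> l > 0 \<and>
       a > 0 \<and> b > 0 \<and> c > 0 \<and> gcd a (gcd b c) = 1 \<and>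
       a < b + c \<and> b < a + c \<and> c < a + b \<and>
       4 * heron_area (real a) (real b) (real c) * sqrt 3 \<notin> \<rat> \<and>
       (2 * (l * \<theta>)\<^sup>2 =
          (real a)\<^sup>2 + (real b)\<^sup>2 + (real c)\<^sup>2 + 4 * heron_area (real a) (real b) (real c) * sqrt 3 \<or>
        2 * (l * \<theta>)\<^sup>2 =
          (real a)\<^sup>2 + (real b)\<^sup>2 + (real c)\<^sup>2 - 4 * heron_area (real a) (real b) (real c) * sqrt 3))"
    (is "_ \<longleftrightarrow> ?R")
proof
  have irrat: "\<theta>\<^sup>2 \<notin> \<rat>"
  proof
    assume "\<theta>\<^sup>2 \<in> \<rat>"
    then have "\<theta>\<^sup>2 - \<alpha> \<in> \<rat>" "\<alpha> - \<theta>\<^sup>2 \<in> \<rat>" using \<open>\<alpha> \<in> \<rat>\<close> by simp_all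
    with assms(6,7) show False by auto
  qed
  assume "good \<theta>"
  then obtain p q r where rat: "p \<in> \<rat>" "q \<in> \<rat>" "r \<in> \<rat>" and nonneg: "0 \<le> p" "0 \<le> q" "0 \<le> r"
    and rel: "(2 * \<theta>\<^sup>2 - (p\<^sup>2 + q\<^sup>2 + r\<^sup>2))\<^sup>2 = 3 * heron_product p q r"
    using good_iff_relation[OF \<open>\<theta> > 0\<close>] by blast
  \<comment> \<open>Equality would make \<open>\<theta>\<^sup>2\<close> rational, so the square in
    \<open>rel\<close> is strictly positive, which excludes degenerate triangles.\<close>
  have "2 * \<theta>\<^sup>2 \<noteq> p\<^sup>2 + q\<^sup>2 + r\<^sup>2"
  proof
    assume "2 * \<theta>\<^sup>2 = p\<^sup>2 + q\<^sup>2 + r\<^sup>2"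
    then have "\<theta>\<^sup>2 = (p\<^sup>2 + q\<^sup>2 + r\<^sup>2) / 2" by simp
    also have "\<dots> \<in> \<rat>" using rat by simp
    finally show False using irrat by simp
  qed
  then have "3 * heron_product p q r > 0" unfolding rel[symmetric] by simp
  then have hpos: "heron_product p q r > 0" by simp
  note tri = strict_triangle_if_heron_product_pos[OF nonneg this]
  obtain l :: real and a b c :: nat
    where l: "l \<in> \<rat>" "l > 0" and abc: "a > 0" "b > 0" "c > 0" "gcd a (gcd b c) = 1"
      and scale: "real a = l * p" "real b = l * q" "real c = l * r"
    using pos_Rats_common_primitive_multiple[OF rat tri(4-6)] by metis
  have "real a < real (b + c)" "real b < real (a + c)" "real c < real (a + b)"
    using tri(1-3) l by (simp_all add: scale flip: distrib_left)
  then have tri': "a < b + c" "b < a + c" "c < a + b" by linarith+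
  define h where "h = sqrt (3 * heron_product a b c)"
  have "h\<^sup>2 = 3 * heron_product a b c"
    using hpos l by (simp add: h_def scale heron_product_scale)
  also have "\<dots> = l ^ 4 * (2 * \<theta>\<^sup>2 - (p\<^sup>2 + q\<^sup>2 + r\<^sup>2))\<^sup>2"
    by (simp add: rel scale heron_product_scale)
  also have "\<dots> = (2 * (l * \<theta>)\<^sup>2 - ((real a)\<^sup>2 + (real b)\<^sup>2 + (real c)\<^sup>2))\<^sup>2"
    unfolding scale by algebra
  \<comment> \<open>Equal squares leave two signs, which are the two alternatives of the
    theorem.\<close>
  finally have alt: "2 * (l * \<theta>)\<^sup>2 = (real a)\<^sup>2 + (real b)\<^sup>2 + (real c)\<^sup>2 + h \<or>
      2 * (l * \<theta>)\<^sup>2 = (real a)\<^sup>2 + (real b)\<^sup>2 + (real c)\<^sup>2 - h"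
    unfolding power2_eq_iff by argo
  \<comment> \<open>Either alternative would carry rationality of \<open>h\<close> over to
    \<open>\<theta>\<^sup>2\<close>.\<close>
  have "h \<notin> \<rat>"
  proof
    assume "h \<in> \<rat>"
    then have "2 * (l * \<theta>)\<^sup>2 \<in> \<rat>" using alt by auto
    then have "2 * (l * \<theta>)\<^sup>2 / (2 * l\<^sup>2) \<in> \<rat>" using l by (intro Rats_divide) simp_all
    then show False using irrat l by (simp add: power_mult_distrib)
  qed
  moreover have "4 * heron_area (real a) (real b) (real c) * sqrt 3 = h"
    unfolding h_def by (rule four_heron_area_sqrt3)
  ultimately show ?R
    using l abc tri' alt
    by (intro exI[of _ l] exI[of _ a] exI[of _ b] exI[of _ c] conjI) simp_all
next
  assume ?R
  then obtain l :: real and a b c :: nat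
    where l: "l \<in> \<rat>" "l > 0" and tri: "a < b + c" "b < a + c" "c < a + b"
      and alt: "2 * (l * \<theta>)\<^sup>2 =
          (real a)\<^sup>2 + (real b)\<^sup>2 + (real c)\<^sup>2 + sqrt (3 * heron_product a b c) \<or>
        2 * (l * \<theta>)\<^sup>2 =
          (real a)\<^sup>2 + (real b)\<^sup>2 + (real c)\<^sup>2 - sqrt (3 * heron_product a b c)"
    unfolding four_heron_area_sqrt3 by blast
  \<comment> \<open>Nonnegativity ensures that squaring the root returns its radicand, so both sign
    choices yield the same relation.\<close>
  have "heron_product a b c \<ge> 0"
    using tri unfolding heron_product_def by (intro mult_nonneg_nonneg) linarith+
  then have rel: "(2 * (l * \<theta>)\<^sup>2 - ((real a)\<^sup>2 + (real b)\<^sup>2 + (real c)\<^sup>2))\<^sup>2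
      = 3 * heron_product a b c"
    using alt by auto
  \<comment> \<open>Undoing the scaling gives the rational distances for side \<theta>; the factor
    \<open>l ^ 4\<close> then cancels from the relation.\<close>
  define p q r where "p = a / l" and "q = b / l" and "r = c / l"
  have scale: "real a = l * p" "real b = l * q" "real c = l * r"
    using l by (simp_all add: p_def q_def r_def)
  have "l ^ 4 * (2 * \<theta>\<^sup>2 - (p\<^sup>2 + q\<^sup>2 + r\<^sup>2))\<^sup>2
      = (2 * (l * \<theta>)\<^sup>2 - ((real a)\<^sup>2 + (real b)\<^sup>2 + (real c)\<^sup>2))\<^sup>2"
    unfolding scale by algebra
  also have "\<dots> = l ^ 4 * (3 * heron_product p q r)"
    unfolding rel by (simp add: scale heron_product_scale)
  finally have "(2 * \<theta>\<^sup>2 - (p\<^sup>2 + q\<^sup>2 + r\<^sup>2))\<^sup>2 = 3 * heron_product p q r"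
    using l by simp
  moreover have "p \<in> \<rat>" "q \<in> \<rat>" "r \<in> \<rat>" "0 \<le> p" "0 \<le> q" "0 \<le> r"
    using l by (simp_all add: p_def q_def r_def)
  ultimately show "good \<theta>"
    using good_iff_relation[OF \<open>\<theta> > 0\<close>] by blast
qed

end
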